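(* Fix $q\in(0,1)$ and $\rho\in(0,1)$. Let $Z_0,Z_1,Z_2,\ldots$ be independent standard normal variables and, for each $m\ge1$, let $$W_i^{(m)}=\sqrt{\rho}\,Z_0+\sqrt{1-\rho}\,Z_i,\qquad i=1,\ldots,m.$$ Suppose all $m$ hypotheses are true nulls, apply the knockoff+ threshold at nominal level $q$ to the scores $W_1^{(m)},\ldots,W_m^{(m)}$, and let $\widehat{\mathcal R}_m$ and $\mathrm{FDR}_m$ denote its rejection set and false discovery rate. Then, for every $z\neq0$, $$\mathbb P(\widehat{\mathcal R}_m\ne\varnothing\mid Z_0=z)\longrightarrow \mathbf 1\{z>0\}\qquad(m\to\infty).$$ Consequently, $\mathrm{FDR}_m\to\frac12$ as $m\to\infty$. In particular, if $q<1/2$, then $\mathrm{FDR}_m>q$ for all sufficiently large $m$.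
   Context: Let $\mathcal H_0\subseteq\{1,\ldots,m\}$ be the set of true nulls. For signed scores $W_1,\ldots,W_m$ and $t>0$, put $N_+(t)=\#\{i:W_i\ge t\}$, $N_-(t)=\#\{i:W_i\le -t\}$, and $\mathcal T=\{|W_i|:|W_i|>0\}$. The knockoff+ threshold at level $q$ is $$\widehat t=\min\Big\{t\in\mathcal T:\frac{1+N_-(t)}{N_+(t)\vee1}\le q\Big\},$$ with $\widehat t=\infty$ if the set is empty, and the rejection set is $\widehat{\mathcal R}=\{i:W_i\ge\widehat t\}$. Here $a\vee b=\max\{a,b\}$. The false discovery proportion is $\mathrm{FDP}=|\widehat{\mathcal R}\cap\mathcal H_0|/(|\widehat{\mathcal R}|\vee1)$ and $\mathrm{FDR}=\mathbb E(\mathrm{FDP})$. Conditioning on $Z_0=z$ means that the scores are independent with law $N(\sqrt\rho\,z,1-\rho)$. *)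

theory Defs
  imports "HOL-Probability.Probability"
begin

definition n_pos :: "nat \<Rightarrow> (nat \<Rightarrow> real) \<Rightarrow> real \<Rightarrow> nat" where
  "n_pos m w t = card {i \<in> {1..m}. w i \<ge> t}"

definition n_neg :: "nat \<Rightarrow> (nat \<Rightarrow> real) \<Rightarrow> real \<Rightarrow> nat" where
  "n_neg m w t = card {i \<in> {1..m}. w i \<le> - t}"

definition candidate_thresholds :: "nat \<Rightarrow> (nat \<Rightarrow> real) \<Rightarrow> real set" where
  "candidate_thresholds m w = {\<bar>w i\<bar> | i. i \<in> {1..m} \<and> \<bar>w i\<bar> > 0}"

definition admissible_thresholds :: "nat \<Rightarrow> real \<Rightarrow> (nat \<Rightarrow> real) \<Rightarrow> real set" where
  "admissible_thresholds m q w =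
     {t \<in> candidate_thresholds m w.
        (1 + real (n_neg m w t)) / real (max (n_pos m w t) 1) \<le> q}"

definition knockoff_plus_threshold :: "nat \<Rightarrow> real \<Rightarrow> (nat \<Rightarrow> real) \<Rightarrow> ereal" where
  "knockoff_plus_threshold m q w =
     (if admissible_thresholds m q w = {} then \<infinity>
      else ereal (Min (admissible_thresholds m q w)))"

definition rejections :: "nat \<Rightarrow> real \<Rightarrow> (nat \<Rightarrow> real) \<Rightarrow> nat set" where
  "rejections m q w = {i \<in> {1..m}. ereal (w i) \<ge> knockoff_plus_threshold m q w}"

definition fdp :: "nat \<Rightarrow> real \<Rightarrow> nat set \<Rightarrow> (nat \<Rightarrow> real) \<Rightarrow> real" where
  "fdp m q H0 w = real (card (rejections m q w \<inter> H0)) / real (max (card (rejections m q w)) 1)"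

definition fdr :: "'a measure \<Rightarrow> nat \<Rightarrow> real \<Rightarrow> nat set \<Rightarrow> (nat \<Rightarrow> 'a \<Rightarrow> real) \<Rightarrow> real" where
  "fdr M m q H0 W = (\<integral>\<omega>. fdp m q H0 (\<lambda>i. W i \<omega>) \<partial>M)"

definition score :: "real \<Rightarrow> (nat \<Rightarrow> 'a \<Rightarrow> real) \<Rightarrow> nat \<Rightarrow> 'a \<Rightarrow> real" where
  "score \<rho> Z i \<omega> = sqrt \<rho> * Z 0 \<omega> + sqrt (1 - \<rho>) * Z i \<omega>"

text \<open>The conditional law of the \<open>m\<close> scores given that the common factor \<open>Z 0\<close> equals \<open>z\<close>:
  independent normals with mean \<open>sqrt \<rho> * z\<close> and variance \<open>1 - \<rho>\<close>.  The second argument of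
  \<^const>\<open>normal_density\<close> is the standard deviation.\<close>

definition conditional_score_law :: "real \<Rightarrow> real \<Rightarrow> nat \<Rightarrow> (nat \<Rightarrow> real) measure" where
  "conditional_score_law \<rho> z m =
     (\<Pi>\<^sub>M i\<in>{1..m}. density lborel (\<lambda>x. ennreal (normal_density (sqrt \<rho> * z) (sqrt (1 - \<rho>)) x)))"

end

theory Submission
  imports Defs
begin

text \<open>
  Some score is rejected iff some \<open>W\<^sub>i > 0\<close> satisfies \<open>1 + N\<^sub>-(W\<^sub>i) \<le> q N\<^sub>+(W\<^sub>i)\<close>, and under the full
  null the FDP is the indicator of this event. Let the scores be i.i.d. normal with mean \<open>\<mu>\<close> and
  standard deviation \<open>\<sigma>\<close>; their density satisfies \<open>\<phi>(t) = exp (2 \<mu> t / \<sigma>\<^sup>2) \<phi>(-t)\<close>.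
  If \<open>\<mu> > 0\<close>, fix a level \<open>t\<close> at which the lower tail is much lighter than the upper one; a Chernoff
  bound for \<open>N\<^sub>-(t) - q N\<^sub>+(t)\<close> makes this level admissible with probability tending to 1.
  If \<open>\<mu> < 0\<close>, a union bound over \<open>i\<close> and a Chernoff bound for \<open>q N\<^sub>+ - N\<^sub>-\<close> given \<open>W\<^sub>i = t\<close> bound the
  rejection probability by \<open>\<integral>\<^sub>t\<^sub>>\<^sub>0 m (1 - c p(t))\<^bsup>m-1\<^esup> \<phi>(t) dt\<close>, where \<open>p(t)\<close> is the lower tail beyond
  \<open>-t\<close>. The part \<open>t \<le> K\<close> decays exponentially in \<open>m\<close>; on \<open>t \<ge> K\<close> the factor
  \<open>exp (2 \<mu> K / \<sigma>\<^sup>2)\<close> multiplies an integral with \<open>\<phi>(-t)\<close> in place of \<open>\<phi>(t)\<close>, which is at most \<open>1 / c\<close> for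
  every \<open>m\<close>. Averaging over \<open>Z\<^sub>0\<close> with dominated convergence gives the limit of the FDR.
\<close>

subsection \<open>Admissible levels\<close>

lemma n_pos_eq_sum: "real (n_pos m w t) = (\<Sum>i\<in>{1..m}. if t \<le> w i then 1 else 0)"
  by (subst sum.inter_filter[symmetric]) (simp_all add: n_pos_def)

lemma n_neg_eq_sum: "real (n_neg m w t) = (\<Sum>i\<in>{1..m}. if w i \<le> - t then 1 else 0)"
  by (subst sum.inter_filter[symmetric]) (simp_all add: n_neg_def)

lemma sum_tail_weights:
  fixes \<alpha> \<beta> :: real
  shows "(\<Sum>i\<in>{1..m}. (if t \<le> w i then \<alpha> else 0) + (if w i \<le> - t then \<beta> else 0)) =
    \<alpha> * real (n_pos m w t) + \<beta> * real (n_neg m w t)"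
  unfolding n_pos_eq_sum n_neg_eq_sum sum_distrib_left sum.distrib[symmetric]
  by (rule sum.cong) auto

lemma n_neg_antimono: "s \<le> t \<Longrightarrow> n_neg m w t \<le> n_neg m w s"
  unfolding n_neg_def by (intro card_mono) auto

text \<open>Raising \<open>t\<close> to the smallest score that is at least \<open>t\<close> keeps
  \<open>n_pos\<close> and can only lower \<open>n_neg\<close>. Such a score exists, since the
  assumed inequality fails when \<open>n_pos\<close> is 0.\<close>

lemma threshold_attained_by_score:
  assumes q: "0 < q" and t: "1 + real (n_neg m w t) \<le> q * real (n_pos m w t)"
  obtains i where "i \<in> {1..m}" "w i \<ge> t" "1 + real (n_neg m w (w i)) \<le> q * real (n_pos m w (w i))"
proof -
  define A where "A = {i \<in> {1..m}. w i \<ge> t}"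
  have "n_pos m w t \<noteq> 0"
  proof
    assume "n_pos m w t = 0"
    with t show False by simp
  qed
  hence A: "finite (w ` A)" "w ` A \<noteq> {}"
    by (auto simp: A_def n_pos_def)
  from Min_in[OF A] obtain i where i: "i \<in> A" "w i = Min (w ` A)"
    by auto
  have min: "w i \<le> w j" if "j \<in> A" for j
    using that A i by simp
  have "n_pos m w (w i) = n_pos m w t"
    unfolding n_pos_def using i(1) min by (intro arg_cong[where f = card]) (force simp: A_def)
  moreover have "n_neg m w (w i) \<le> n_neg m w t"
    using i by (intro n_neg_antimono) (auto simp: A_def)
  ultimately show thesis
    using t i that[of i] by (auto simp: A_def)
qed

text \<open>When \<open>n_pos\<close> is 0, the ratio is at least 1 and so exceeds \<open>q\<close>,
  and the product form fails as well. Otherwise the denominator is \<open>n_pos\<close> and can be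
  multiplied out.\<close>

lemma admissible_thresholds_iff:
  assumes q: "0 < q" "q < 1"
  shows "t \<in> admissible_thresholds m q w \<longleftrightarrow>
    t \<in> candidate_thresholds m w \<and> 1 + real (n_neg m w t) \<le> q * real (n_pos m w t)"
proof (cases "n_pos m w t = 0")
  case True
  with q show ?thesis by (simp add: admissible_thresholds_def)
next
  case False
  hence "max (n_pos m w t) 1 = n_pos m w t" "0 < real (n_pos m w t)" by auto
  thus ?thesis
    by (simp add: admissible_thresholds_def pos_divide_le_eq)
qed

text \<open>Removes \<open>Min\<close> and the infinite threshold from later arguments. An
  admissible level may be the absolute value of a negative score, so it is first moved to a positive
  score. Conversely, an admissible positive score is at least the minimum and is itself
  rejected.\<close>

lemma rejections_nonempty_iff:
  assumes q: "0 < q" "q < 1"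
  shows "rejections m q w \<noteq> {} \<longleftrightarrow>
    (\<exists>i\<in>{1..m}. 0 < w i \<and> 1 + real (n_neg m w (w i)) \<le> q * real (n_pos m w (w i)))"
    (is "_ \<longleftrightarrow> ?R")
proof
  assume "rejections m q w \<noteq> {}"
  hence "admissible_thresholds m q w \<noteq> {}"
    by (auto simp: rejections_def knockoff_plus_threshold_def)
  then obtain t where t: "0 < t" "1 + real (n_neg m w t) \<le> q * real (n_pos m w t)"
    unfolding ex_in_conv[symmetric] admissible_thresholds_iff[OF q] candidate_thresholds_def by blast
  from threshold_attained_by_score[OF q(1) t(2)] obtain i where
    "i \<in> {1..m}" "t \<le> w i" "1 + real (n_neg m w (w i)) \<le> q * real (n_pos m w (w i))" .
  with t(1) show ?R by (intro bexI[of _ i]) auto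
next
  assume ?R
  then obtain i where i: "i \<in> {1..m}" "0 < w i"
      "1 + real (n_neg m w (w i)) \<le> q * real (n_pos m w (w i))"
    by auto
  hence adm: "w i \<in> admissible_thresholds m q w"
    by (auto simp: admissible_thresholds_iff[OF q] candidate_thresholds_def intro!: exI[of _ i])
  have "finite (admissible_thresholds m q w)"
    by (auto simp: admissible_thresholds_def candidate_thresholds_def)
  hence "i \<in> rejections m q w"
    using adm i(1) by (auto simp: rejections_def knockoff_plus_threshold_def)
  thus "rejections m q w \<noteq> {}" by auto
qed

text \<open>Allows a deterministic level that need not be a candidate threshold, as the Chernoff
  argument for positive mean requires.\<close>

lemma rejections_nonempty_of_level:
  assumes q: "0 < q" "q < 1" and "0 < t" "1 + real (n_neg m w t) \<le> q * real (n_pos m w t)"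
  shows "rejections m q w \<noteq> {}"
proof -
  from threshold_attained_by_score[OF q(1) assms(4)] obtain i where
    "i \<in> {1..m}" "t \<le> w i" "1 + real (n_neg m w (w i)) \<le> q * real (n_pos m w (w i))" .
  with assms(3) show ?thesis
    unfolding rejections_nonempty_iff[OF q] by (intro bexI[of _ i]) auto
qed

text \<open>Points of a product space over \<open>{1..m}\<close> are \<open>undefined\<close>
  elsewhere, and index 0 is reserved for the common factor; values at such indices must be
  exchangeable for others.\<close>

lemma rejections_cong:
  assumes "\<And>i. i \<in> {1..m} \<Longrightarrow> w i = w' i" "0 < q" "q < 1"
  shows "rejections m q w \<noteq> {} \<longleftrightarrow> rejections m q w' \<noteq> {}"
proof -
  have "n_pos m w = n_pos m w'" "n_neg m w = n_neg m w'"
    unfolding n_pos_def n_neg_def fun_eq_iff using assms(1)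
    by (auto intro!: arg_cong[where f = card])
  thus ?thesis
    using assms by (simp add: rejections_nonempty_iff)
qed

text \<open>Every rejection is false, so the quotient is \<open>n / n\<close> with
  \<open>n > 0\<close>, or \<open>0 / 1\<close>.\<close>

lemma fdp_all_null: "fdp m q {1..m} w = indicator {w. rejections m q w \<noteq> {}} w"
proof -
  have "rejections m q w \<subseteq> {1..m}" by (auto simp: rejections_def)
  hence "rejections m q w \<inter> {1..m} = rejections m q w" "finite (rejections m q w)"
    by (auto intro: finite_subset)
  thus ?thesis
    using card_gt_0_iff[of "rejections m q w"]
    by (cases "rejections m q w = {}") (auto simp: fdp_def max_def Suc_le_eq)
qed

section \<open>Measurability of the rejection event\<close>

lemma pred_admissible_score:
  fixes f :: "nat \<Rightarrow> 'b \<Rightarrow> real"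
  assumes f: "\<And>i. i \<in> {1..m} \<Longrightarrow> f i \<in> borel_measurable N" and i: "i \<in> {1..m}"
  shows "Measurable.pred N (\<lambda>x. 0 < f i x \<and>
    1 + real (n_neg m (\<lambda>j. f j x) (f i x)) \<le> q * real (n_pos m (\<lambda>j. f j x) (f i x)))"
proof -
  \<comment> \<open>Extending by 0 makes \<open>g j\<close> measurable without a side condition on
    \<open>j\<close>. The level \<open>g i\<close> is itself random, so the counts are treated as
    sums over comparisons of measurable functions.\<close>
  define g where "g j = (if j \<in> {1..m} then f j else (\<lambda>_. 0))" for j
  have [measurable]: "g j \<in> borel_measurable N" for j
    using f by (auto simp: g_def)
  have "Measurable.pred N (\<lambda>x. 0 < g i x \<and>
      1 + (\<Sum>j\<in>{1..m}. if g j x \<le> - g i x then 1 else 0) \<le>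
      q * (\<Sum>j\<in>{1..m}. if g i x \<le> g j x then 1 else 0))"
    by measurable
  moreover have "(\<Sum>j\<in>{1..m}. if g j x \<le> - g i x then 1 else 0) = (\<Sum>j\<in>{1..m}. if f j x \<le> - f i x then 1 else 0 :: real)"
    "(\<Sum>j\<in>{1..m}. if g i x \<le> g j x then 1 else 0) = (\<Sum>j\<in>{1..m}. if f i x \<le> f j x then 1 else 0 :: real)"
    "g i x = f i x" for x
    using i by (auto simp: g_def simp del: sum.If_cases intro!: sum.cong)
  ultimately show ?thesis
    unfolding n_pos_eq_sum n_neg_eq_sum by simp
qed

lemma pred_rejections_nonempty:
  fixes f :: "nat \<Rightarrow> 'b \<Rightarrow> real"
  assumes "\<And>i. i \<in> {1..m} \<Longrightarrow> f i \<in> borel_measurable N" and q: "0 < q" "q < 1"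
  shows "Measurable.pred N (\<lambda>x. rejections m q (\<lambda>i. f i x) \<noteq> {})"
  unfolding rejections_nonempty_iff[OF q]
  by (intro pred_intros_finite pred_admissible_score assms) auto

text \<open>Since \<open>0 < t\<close>, the two tails are disjoint and the exponential is affine in
  their indicators. This is the one-score moment generating function behind both Chernoff
  bounds.\<close>

lemma nn_integral_exp_two_tails:
  fixes D :: "real measure"
  assumes "prob_space D" and [measurable_cong]: "sets D = sets borel" and t: "0 < t"
  shows "(\<integral>\<^sup>+x. ennreal (exp ((if t \<le> x then \<alpha> else 0) + (if x \<le> - t then \<beta> else 0))) \<partial>D) =
    ennreal (1 + (exp \<alpha> - 1) * measure D {t..} + (exp \<beta> - 1) * measure D {..- t})"
proof -
  interpret prob_space D by fact
  have [simp]: "space D = UNIV"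
    using sets_eq_imp_space_eq[OF assms(2)] by simp
  have eq: "exp ((if t \<le> x then \<alpha> else 0) + (if x \<le> - t then \<beta> else 0)) =
      1 + (exp \<alpha> - 1) * indicator {t..} x + (exp \<beta> - 1) * indicator {..- t} x" for x
    using t by (auto simp: indicator_def)
  have int [simp]: "integrable D (\<lambda>x. indicator A x :: real)" if "A \<in> sets borel" for A
    using that by (intro integrable_real_indicator) (auto simp: assms less_top[symmetric])
  have "(\<integral>\<^sup>+x. ennreal (exp ((if t \<le> x then \<alpha> else 0) + (if x \<le> - t then \<beta> else 0))) \<partial>D) =
      ennreal (\<integral>x. exp ((if t \<le> x then \<alpha> else 0) + (if x \<le> - t then \<beta> else 0)) \<partial>D)"
    by (rule nn_integral_eq_integral) (simp add: eq, simp)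
  also have "(\<integral>x. exp ((if t \<le> x then \<alpha> else 0) + (if x \<le> - t then \<beta> else 0)) \<partial>D) =
      1 + (exp \<alpha> - 1) * measure D {t..} + (exp \<beta> - 1) * measure D {..- t}"
    unfolding eq by (subst Bochner_Integration.integral_add; simp add: prob_space[simplified])+
  finally show ?thesis .
qed

subsection \<open>Tails of the normal law\<close>

abbreviation normal_law :: "real \<Rightarrow> real \<Rightarrow> real measure" where
  "normal_law \<mu> \<sigma> \<equiv> density lborel (\<lambda>x. ennreal (normal_density \<mu> \<sigma> x))"

text \<open>Follows from \<open>(x + \<mu>)\<^sup>2 - (x - \<mu>)\<^sup>2 = 4 * \<mu> * x\<close>,
  divided by \<open>2 * \<sigma>\<^sup>2\<close>.\<close>

lemma normal_density_reflect:
  assumes "0 < \<sigma>"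
  shows "normal_density \<mu> \<sigma> x = exp (2 * \<mu> * x / \<sigma>\<^sup>2) * normal_density \<mu> \<sigma> (- x)"
proof -
  have "- (x - \<mu>)\<^sup>2 / (2 * \<sigma>\<^sup>2) = 2 * \<mu> * x / \<sigma>\<^sup>2 + - (- x - \<mu>)\<^sup>2 / (2 * \<sigma>\<^sup>2)"
    using assms by (simp add: field_simps power2_eq_square)
  thus ?thesis
    unfolding normal_density_def by (simp only: exp_add) simp
qed

text \<open>Substituting \<open>- x\<close> for \<open>x\<close> puts both tails on the same
  half-line, where their densities can be compared pointwise.\<close>

lemma emeasure_normal_lower_tail:
  "emeasure (normal_law \<mu> \<sigma>) {..- t} =
    (\<integral>\<^sup>+x. ennreal (normal_density \<mu> \<sigma> (- x)) * indicator {t..} x \<partial>lborel)"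
proof -
  have "emeasure (normal_law \<mu> \<sigma>) {..- t} =
      (\<integral>\<^sup>+x. ennreal (normal_density \<mu> \<sigma> x) * indicator {..- t} x \<partial>lborel)"
    by (simp add: emeasure_density)
  also have "\<dots> = (\<integral>\<^sup>+x. ennreal (normal_density \<mu> \<sigma> (- x)) * indicator {..- t} (- x) \<partial>lborel)"
    by (subst nn_integral_real_affine[where c = "-1" and t = 0]) auto
  also have "\<dots> = (\<integral>\<^sup>+x. ennreal (normal_density \<mu> \<sigma> (- x)) * indicator {t..} x \<partial>lborel)"
    by (simp add: indicator_def)
  finally show ?thesis .
qed

text \<open>By reflection the density at \<open>- x\<close> is
  \<open>exp (- 2 * \<mu> * x / \<sigma>\<^sup>2)\<close> times that at \<open>x\<close>; on
  \<open>x \<ge> t\<close> this factor is largest at \<open>t\<close>.\<close>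

lemma normal_tail_ratio:
  assumes \<sigma>: "0 < \<sigma>" and \<mu>: "0 \<le> \<mu>"
  shows "measure (normal_law \<mu> \<sigma>) {..- t} \<le>
    exp (- 2 * \<mu> * t / \<sigma>\<^sup>2) * measure (normal_law \<mu> \<sigma>) {t..}"
proof -
  interpret prob_space "normal_law \<mu> \<sigma>" by (rule prob_space_normal_density[OF \<sigma>])
  have "emeasure (normal_law \<mu> \<sigma>) {..- t} \<le>
      (\<integral>\<^sup>+x. ennreal (exp (- 2 * \<mu> * t / \<sigma>\<^sup>2)) *
        (ennreal (normal_density \<mu> \<sigma> x) * indicator {t..} x) \<partial>lborel)"
    unfolding emeasure_normal_lower_tail
  proof (rule nn_integral_mono)
    fix x :: real
    have "normal_density \<mu> \<sigma> (- x) \<le> exp (- 2 * \<mu> * t / \<sigma>\<^sup>2) * normal_density \<mu> \<sigma> x" if "t \<le> x"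
      using that \<mu> \<sigma> by (subst normal_density_reflect)
        (auto intro!: mult_right_mono divide_right_mono mult_left_mono)
    thus "ennreal (normal_density \<mu> \<sigma> (- x)) * indicator {t..} x \<le>
        ennreal (exp (- 2 * \<mu> * t / \<sigma>\<^sup>2)) * (ennreal (normal_density \<mu> \<sigma> x) * indicator {t..} x)"
      by (auto simp: indicator_def ennreal_mult[symmetric] intro!: ennreal_leI)
  qed
  also have "\<dots> = ennreal (exp (- 2 * \<mu> * t / \<sigma>\<^sup>2)) * emeasure (normal_law \<mu> \<sigma>) {t..}"
    by (subst nn_integral_cmult) (auto simp: emeasure_density)
  finally show ?thesis
    by (simp add: emeasure_eq_measure ennreal_mult[symmetric])
qed

lemma normal_upper_tail_le_lower_tail:
  assumes \<sigma>: "0 < \<sigma>" and \<mu>: "\<mu> \<le> 0" and t: "0 \<le> t"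
  shows "measure (normal_law \<mu> \<sigma>) {t..} \<le> measure (normal_law \<mu> \<sigma>) {..- t}"
proof -
  interpret prob_space "normal_law \<mu> \<sigma>" by (rule prob_space_normal_density[OF \<sigma>])
  have "emeasure (normal_law \<mu> \<sigma>) {t..} =
      (\<integral>\<^sup>+x. ennreal (normal_density \<mu> \<sigma> x) * indicator {t..} x \<partial>lborel)"
    by (simp add: emeasure_density)
  also have "\<dots> \<le> emeasure (normal_law \<mu> \<sigma>) {..- t}"
    unfolding emeasure_normal_lower_tail
  proof (rule nn_integral_mono)
    fix x :: real
    have "normal_density \<mu> \<sigma> x \<le> 1 * normal_density \<mu> \<sigma> (- x)" if "t \<le> x"
      unfolding normal_density_reflect[OF \<sigma>, of \<mu> x]
      using that \<mu> \<sigma> t by (intro mult_right_mono) (auto simp: divide_nonpos_pos mult_nonpos_nonneg)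
    thus "ennreal (normal_density \<mu> \<sigma> x) * indicator {t..} x \<le>
        ennreal (normal_density \<mu> \<sigma> (- x)) * indicator {t..} x"
      by (auto simp: indicator_def intro!: ennreal_leI)
  qed
  finally show ?thesis
    by (simp add: emeasure_eq_measure)
qed

text \<open>The density is positive everywhere, so null sets of the law are Lebesgue null; a unit
  interval inside the tail is not.\<close>

lemma normal_tail_pos:
  assumes \<sigma>: "0 < \<sigma>"
  shows "0 < measure (normal_law \<mu> \<sigma>) {t..}" "0 < measure (normal_law \<mu> \<sigma>) {..t}"
proof -
  interpret prob_space "normal_law \<mu> \<sigma>" by (rule prob_space_normal_density[OF \<sigma>])
  have "emeasure (normal_law \<mu> \<sigma>) A \<noteq> 0" if "emeasure lborel A \<noteq> 0" "A \<in> sets borel" for A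
  proof
    assume "emeasure (normal_law \<mu> \<sigma>) A = 0"
    hence "A \<in> null_sets (normal_law \<mu> \<sigma>)" using that by auto
    hence "A \<in> null_sets lborel"
      using normal_density_pos[OF \<sigma>, of \<mu>]
      by (auto simp: null_sets_density_iff AE_iff_null that normal_density_nonneg not_le
        less_imp_neq[symmetric] dest: less_imp_le intro: that(2))
    with that show False by auto
  qed
  from this[of "{t..t + 1}"] this[of "{t - 1..t}"]
  have "0 < measure (normal_law \<mu> \<sigma>) {t..t + 1}" "0 < measure (normal_law \<mu> \<sigma>) {t - 1..t}"
    by (auto simp: emeasure_eq_measure zero_less_measure_iff)
  moreover have "measure (normal_law \<mu> \<sigma>) {t..t + 1} \<le> measure (normal_law \<mu> \<sigma>) {t..}"
    "measure (normal_law \<mu> \<sigma>) {t - 1..t} \<le> measure (normal_law \<mu> \<sigma>) {..t}"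
    by (auto intro!: finite_measure_mono)
  ultimately show "0 < measure (normal_law \<mu> \<sigma>) {t..}" "0 < measure (normal_law \<mu> \<sigma>) {..t}"
    by linarith+
qed

lemma DERIV_normal_cdf:
  assumes \<sigma>: "0 < \<sigma>"
  shows "((\<lambda>x. measure (normal_law \<mu> \<sigma>) {..x}) has_real_derivative normal_density \<mu> \<sigma> x) (at x)"
proof -
  let ?f = "normal_density \<mu> \<sigma>"
  interpret prob_space "normal_law \<mu> \<sigma>" by (rule prob_space_normal_density[OF \<sigma>])
  have cont: "continuous_on A ?f" for A
    unfolding normal_density_def using \<sigma> by (intro continuous_intros) auto
  \<comment> \<open>The integral starts at \<open>x - 1\<close>, so that \<open>x\<close> is
    interior to the interval and the derivative within it is the full derivative.\<close>
  have eq: "measure (normal_law \<mu> \<sigma>) {..y} = measure (normal_law \<mu> \<sigma>) {..<x - 1} + integral {x - 1..y} ?f"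
    if "y \<in> {x - 1..x + 1}" for y
  proof -
    have "{..y} = {..<x - 1} \<union> {x - 1..y}" using that by auto
    hence "measure (normal_law \<mu> \<sigma>) {..y} = measure (normal_law \<mu> \<sigma>) {..<x - 1} + measure (normal_law \<mu> \<sigma>) {x - 1..y}"
      by (simp only:) (rule finite_measure_Union, auto)
    also have "measure (normal_law \<mu> \<sigma>) {x - 1..y} = (\<integral>x\<in>{x - 1..y}. ?f x \<partial>lborel)"
      using integral_density[of "indicator {x - 1..y} :: real \<Rightarrow> real" lborel ?f]
      by (simp add: set_lebesgue_integral_def mult.commute)
    also have "\<dots> = integral {x - 1..y} ?f"
      by (intro set_borel_integral_eq_integral borel_integrable_atLeastAtMost')
        (auto simp: cont)
    finally show ?thesis .
  qed
  have "((\<lambda>y. measure (normal_law \<mu> \<sigma>) {..<x - 1} + integral {x - 1..y} ?f) has_real_derivative ?f x)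
      (at x within {x - 1..x + 1})"
    by (rule derivative_eq_intros integral_has_real_derivative cont refl | simp)+
  hence "((\<lambda>x. measure (normal_law \<mu> \<sigma>) {..x}) has_real_derivative ?f x) (at x within {x - 1..x + 1})"
    by (rule has_field_derivative_transform_within[where d = 1]) (auto simp: eq)
  thus ?thesis
    by (simp add: at_within_Icc_at)
qed

lemma borel_measurable_normal_lower_tail:
  assumes \<sigma>: "0 < \<sigma>"
  shows "(\<lambda>t. measure (normal_law \<mu> \<sigma>) {..- t}) \<in> borel_measurable borel"
proof (rule borel_measurable_continuous_onI, rule continuous_at_imp_continuous_on, safe)
  fix t
  show "isCont (\<lambda>t. measure (normal_law \<mu> \<sigma>) {..- t}) t"
    by (rule isCont_o2[where g = "\<lambda>x. measure (normal_law \<mu> \<sigma>) {..x}"])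
      (auto intro: DERIV_isCont[OF DERIV_normal_cdf[OF \<sigma>]])
qed

lemma normal_lower_tail_tendsto_0:
  assumes "0 < \<sigma>"
  shows "((\<lambda>t. measure (normal_law \<mu> \<sigma>) {..- t}) \<longlongrightarrow> 0) at_top"
proof -
  interpret prob_space "normal_law \<mu> \<sigma>" by (rule prob_space_normal_density[OF assms])
  interpret real_distribution "normal_law \<mu> \<sigma>" by unfold_locales auto
  have "((\<lambda>t. cdf (normal_law \<mu> \<sigma>) (- t)) \<longlongrightarrow> 0) at_top"
    by (rule filterlim_compose[OF cdf_lim_at_bot filterlim_uminus_at_bot_at_top])
  thus ?thesis by (simp add: cdf_def)
qed

text \<open>The integrand is the derivative of \<open>?F\<close>, which increases to
  \<open>1 / c\<close> at infinity, so the bound is uniform in \<open>m\<close>. For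
  \<open>c = 1\<close> and \<open>m > 0\<close> the integrand is, on \<open>{a..}\<close>, the
  density of the maximum of \<open>m\<close> independent copies of the reflected score.\<close>

lemma nn_integral_lower_tail_power:
  assumes \<sigma>: "0 < \<sigma>" and c: "0 < c" "c \<le> 1"
  shows "(\<integral>\<^sup>+t. ennreal (real m * (1 - c * measure (normal_law \<mu> \<sigma>) {..- t}) ^ (m - 1) *
      normal_density \<mu> \<sigma> (- t)) * indicator {a..} t \<partial>lborel) \<le> ennreal (1 / c)"
proof -
  let ?P = "\<lambda>t. measure (normal_law \<mu> \<sigma>) {..- t}"
  let ?F = "\<lambda>t. (1 - c * ?P t) ^ m / c"
  interpret prob_space "normal_law \<mu> \<sigma>" by (rule prob_space_normal_density[OF \<sigma>])
  note [measurable] = borel_measurable_normal_lower_tail[OF \<sigma>]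
  have nonneg: "0 \<le> 1 - c * ?P t" for t
    using mult_mono[of c 1 "?P t" 1] c by simp
  have "(\<integral>\<^sup>+t. ennreal (real m * (1 - c * ?P t) ^ (m - 1) * normal_density \<mu> \<sigma> (- t)) * indicator {a..} t \<partial>lborel)
      = ennreal (1 / c - ?F a)"
  proof (subst nn_integral_FTC_atLeast[where F = ?F and T = "1 / c"])
    fix t
    have "(?P has_real_derivative normal_density \<mu> \<sigma> (- t) * - 1) (at t)"
      by (rule DERIV_chain2[OF DERIV_normal_cdf[OF \<sigma>]]) (auto intro!: derivative_eq_intros)
    thus "(?F has_real_derivative real m * (1 - c * ?P t) ^ (m - 1) * normal_density \<mu> \<sigma> (- t)) (at t)"
      using c by (auto intro!: derivative_eq_intros simp: field_simps)
    show "0 \<le> real m * (1 - c * ?P t) ^ (m - 1) * normal_density \<mu> \<sigma> (- t)"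
      using nonneg by simp
    show "(?F \<longlongrightarrow> 1 / c) at_top"
      using c by (auto intro!: tendsto_eq_intros normal_lower_tail_tendsto_0[OF \<sigma>])
  qed auto
  also have "\<dots> \<le> ennreal (1 / c)"
    using nonneg[of a] c by (intro ennreal_leI) simp
  finally show ?thesis .
qed

subsection \<open>Limits of the rejection probability for i.i.d. normal scores\<close>

text \<open>Turns the exponential of a combination of the counts into a product over coordinates,
  whose integral over a product measure factorizes.\<close>

lemma exp_sum_tail_weights:
  fixes \<alpha> \<beta> :: real
  shows "(\<Prod>i\<in>{1..m}. ennreal (exp ((if t \<le> w i then \<alpha> else 0) + (if w i \<le> - t then \<beta> else 0)))) =
    ennreal (exp (\<alpha> * real (n_pos m w t) + \<beta> * real (n_neg m w t)))"
  by (subst prod_ennreal) (simp_all only: exp_sum[symmetric] finite_atLeastAtMost sum_tail_weights exp_ge_zero)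

lemma tendsto_exp_neg_mult:
  fixes a :: real
  assumes "a < 0"
  shows "((\<lambda>t. exp (a * t)) \<longlongrightarrow> 0) at_top"
  by (rule filterlim_compose[OF exp_at_bot filterlim_tendsto_neg_mult_at_bot[OF tendsto_const assms filterlim_ident]])

text \<open>At a fixed level \<open>t\<close>, the probability of no rejection is at most
  \<open>exp 1 * B ^ m\<close>, where \<open>B\<close> is the mean of the one-score weight with
  \<open>\<alpha> = - q\<close> and \<open>\<beta> = 1\<close>.\<close>

lemma prob_rejections_nonempty_tendsto_1:
  assumes q: "0 < q" "q < 1" and \<sigma>: "0 < \<sigma>" and \<mu>: "0 < \<mu>"
  shows "(\<lambda>m. \<P>(w in (\<Pi>\<^sub>M i\<in>{1..m}. normal_law \<mu> \<sigma>). rejections m q w \<noteq> {})) \<longlonglongrightarrow> 1"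
proof -
  let ?D = "normal_law \<mu> \<sigma>" and ?P = "\<lambda>m. \<Pi>\<^sub>M i\<in>{1..m}. normal_law \<mu> \<sigma>"
  interpret D: prob_space ?D by (rule prob_space_normal_density[OF \<sigma>])
  interpret product_prob_space "\<lambda>_::nat. ?D" by unfold_locales
  have "((\<lambda>t. exp ((- 2 * \<mu> / \<sigma>\<^sup>2) * t)) \<longlongrightarrow> 0) at_top"
    using \<mu> \<sigma> by (intro tendsto_exp_neg_mult) simp
  \<comment> \<open>The right-hand side is the ratio of lower to upper tail below which
    \<open>B < 1\<close>.\<close>
  hence "\<forall>\<^sub>F t in at_top. exp ((- 2 * \<mu> / \<sigma>\<^sup>2) * t) < (1 - exp (- q)) / (exp 1 - 1)"
    using q by (intro order_tendstoD) auto
  with eventually_gt_at_top[of 0] have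
    "\<forall>\<^sub>F t in at_top. 0 < t \<and> exp ((- 2 * \<mu> / \<sigma>\<^sup>2) * t) < (1 - exp (- q)) / (exp 1 - 1)"
    by (rule eventually_conj)
  then obtain t where t: "0 < t" "exp (- 2 * \<mu> * t / \<sigma>\<^sup>2) < (1 - exp (- q)) / (exp 1 - 1)"
    by (auto dest!: eventually_happens)
  define B where "B = 1 + (exp (- q) - 1) * measure ?D {t..} + (exp 1 - 1) * measure ?D {..- t}"
  have "(exp 1 - 1) * measure ?D {..- t} \<le> (exp 1 - 1) * (exp (- 2 * \<mu> * t / \<sigma>\<^sup>2) * measure ?D {t..})"
    using normal_tail_ratio[OF \<sigma>, of \<mu> t] \<mu> by (intro mult_left_mono) auto
  also have "\<dots> = ((exp 1 - 1) * exp (- 2 * \<mu> * t / \<sigma>\<^sup>2)) * measure ?D {t..}"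
    by simp
  also have "\<dots> < (1 - exp (- q)) * measure ?D {t..}"
    using t(2) by (intro mult_strict_right_mono normal_tail_pos[OF \<sigma>]) (simp add: pos_less_divide_eq mult.commute)
  finally have "B < 1"
    by (simp add: B_def algebra_simps)
  have "(1 - exp (- q)) * measure ?D {t..} \<le> 1 * 1"
    using q by (intro mult_mono) auto
  moreover have "0 \<le> (exp 1 - 1) * measure ?D {..- t}"
    by simp
  ultimately have "0 \<le> B"
    by (simp add: B_def algebra_simps)
  have bound: "1 - exp 1 * B ^ m \<le> \<P>(w in ?P m. rejections m q w \<noteq> {})" for m
  proof -
    interpret Q: prob_space "?P m" by (intro prob_space_PiM) unfold_locales
    have ne: "{w \<in> space (?P m). rejections m q w \<noteq> {}} \<in> sets (?P m)"
      by (rule predE, rule pred_rejections_nonempty[OF _ q]) (auto intro!: measurable_component_singleton)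
    have empty: "{w \<in> space (?P m). rejections m q w = {}} \<in> sets (?P m)"
      using sets.sets_Collect_neg[OF ne] by simp
    have "emeasure (?P m) {w \<in> space (?P m). rejections m q w = {}} =
        (\<integral>\<^sup>+w. indicator {w \<in> space (?P m). rejections m q w = {}} w \<partial>?P m)"
      by (rule nn_integral_indicator[OF empty, symmetric])
    also have "\<dots> \<le> (\<integral>\<^sup>+w. ennreal (exp 1) * (\<Prod>i\<in>{1..m}.
        ennreal (exp ((if t \<le> w i then - q else 0) + (if w i \<le> - t then 1 else 0)))) \<partial>?P m)"
    proof (rule nn_integral_mono)
      fix w
      \<comment> \<open>Without rejections the level \<open>t\<close> is not admissible, so the
        total exponent is positive. The factor \<open>exp 1\<close> accounts for the added 1 in the
        knockoff+ ratio.\<close>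
      have "1 \<le> exp 1 * exp (- q * real (n_pos m w t) + 1 * real (n_neg m w t))" if "rejections m q w = {}"
        using that rejections_nonempty_of_level[OF q t(1), of m w]
        unfolding exp_add[symmetric] one_le_exp_iff by (cases "rejections m q w = {}") linarith+
      thus "indicator {w \<in> space (?P m). rejections m q w = {}} w \<le>
          ennreal (exp 1) * (\<Prod>i\<in>{1..m}.
          ennreal (exp ((if t \<le> w i then - q else 0) + (if w i \<le> - t then 1 else 0))))"
        unfolding exp_sum_tail_weights
        by (subst ennreal_mult[symmetric]) (auto simp: indicator_def)
    qed
    also have "\<dots> = ennreal (exp 1) * (\<Prod>i\<in>{1..m}. \<integral>\<^sup>+x.
        ennreal (exp ((if t \<le> x then - q else 0) + (if x \<le> - t then 1 else 0))) \<partial>?D)"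
      by (subst nn_integral_cmult, measurable, subst product_nn_integral_prod) auto
    also have "\<dots> = ennreal (exp 1 * B ^ m)"
      by (subst nn_integral_exp_two_tails[OF D.prob_space_axioms _ t(1)])
        (auto simp: B_def[symmetric] \<open>0 \<le> B\<close> ennreal_power ennreal_mult)
    finally have "Q.prob {w \<in> space (?P m). rejections m q w = {}} \<le> exp 1 * B ^ m"
      unfolding Q.emeasure_eq_measure using \<open>0 \<le> B\<close> by simp
    moreover have "Q.prob {w \<in> space (?P m). \<not> rejections m q w \<noteq> {}} =
        1 - Q.prob {w \<in> space (?P m). rejections m q w \<noteq> {}}"
      by (rule Q.prob_neg[OF ne])
    ultimately show ?thesis by simp
  qed
  have "(\<lambda>m. 1 - exp 1 * B ^ m) \<longlonglongrightarrow> 1 - exp 1 * 0"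
    using \<open>B < 1\<close> \<open>0 \<le> B\<close> by (intro tendsto_intros LIMSEQ_power_zero) auto
  hence lim: "(\<lambda>m. 1 - exp 1 * B ^ m) \<longlonglongrightarrow> 1" by simp
  show ?thesis
  proof (rule tendsto_sandwich[OF _ _ lim tendsto_const])
    show "\<forall>\<^sub>F m in sequentially. \<P>(w in ?P m. rejections m q w \<noteq> {}) \<le> 1"
      by (intro always_eventually allI prob_space.prob_le_1 prob_space_PiM) unfold_locales
  qed (use bound in auto)
qed

text \<open>
  Given \<open>W\<^sub>i = t\<close>, every other score carries the weight \<open>exp (l q)\<close> beyond \<open>t\<close> and \<open>exp (- l)\<close> beyond
  \<open>- t\<close>. On the event, \<open>q N\<^sub>+ - N\<^sub>- \<ge> 1 - q\<close> for the counts without \<open>i\<close>, so the product of the weights is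
  at least 1, while the mean weight is at most \<open>1 - c P(W \<le> - t)\<close>.
\<close>

lemma emeasure_admissible_score_le:
  assumes q: "0 < q" "q < 1" and \<sigma>: "0 < \<sigma>" and \<mu>: "\<mu> \<le> 0" and l: "0 < l" and i: "i \<in> {1..m}"
  defines "P \<equiv> (\<Pi>\<^sub>M i\<in>{1..m}. normal_law \<mu> \<sigma>)"
  defines "c \<equiv> 2 - exp (- l) - exp (l * q)"
  assumes c: "0 \<le> c"
  shows "emeasure P {w \<in> space P. 0 < w i \<and> 1 + real (n_neg m w (w i)) \<le> q * real (n_pos m w (w i))} \<le>
    (\<integral>\<^sup>+t. ennreal ((1 - c * measure (normal_law \<mu> \<sigma>) {..- t}) ^ (m - 1)) * indicator {0<..} t \<partial>normal_law \<mu> \<sigma>)"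
proof -
  let ?D = "normal_law \<mu> \<sigma>" and ?J = "{1..m} - {i}"
  interpret D: prob_space ?D by (rule prob_space_normal_density[OF \<sigma>])
  interpret product_prob_space "\<lambda>_::nat. ?D" by unfold_locales
  have [measurable_cong]: "sets P = sets (\<Pi>\<^sub>M i\<in>{1..m}. borel)"
    unfolding P_def by (intro sets_PiM_cong) auto
  define k where "k t x = ennreal (exp ((if t \<le> x then l * q else 0) + (if x \<le> - t then - l else 0)))"
    for t x :: real
  have k_meas [measurable]: "(\<lambda>x. k (f x) (g x)) \<in> borel_measurable N"
    if [measurable]: "f \<in> borel_measurable N" "g \<in> borel_measurable N" for f g and N :: "'b measure"
    unfolding k_def by measurable
  define E where "E = {w \<in> space P. 0 < w i \<and> 1 + real (n_neg m w (w i)) \<le> q * real (n_pos m w (w i))}"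
  have comp: "(\<lambda>w. w j) \<in> borel_measurable P" if "j \<in> {1..m}" for j
    using that unfolding P_def by measurable
  have "E \<in> sets P"
    unfolding E_def by (intro predE pred_admissible_score comp i)
  hence "emeasure P E = (\<integral>\<^sup>+w. indicator E w \<partial>P)"
    by simp
  also have "\<dots> \<le> (\<integral>\<^sup>+w. (\<Prod>j\<in>?J. k (w i) (w j)) * indicator {0<..} (w i) \<partial>P)"
  proof (rule nn_integral_mono)
    fix w
    have "1 \<le> (\<Prod>j\<in>?J. k (w i) (w j))" if w: "w \<in> E"
    proof -
      define g where "g j = (if w i \<le> w j then l * q else 0) + (if w j \<le> - w i then - l else 0)" for j
      have "(\<Sum>j\<in>{1..m}. g j) = g i + (\<Sum>j\<in>?J. g j)"
        using i by (intro sum.remove) auto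
      moreover have "(\<Sum>j\<in>{1..m}. g j) = l * q * real (n_pos m w (w i)) + (- l) * real (n_neg m w (w i))"
        unfolding g_def by (rule sum_tail_weights)
      \<comment> \<open>Score \<open>i\<close> meets its own level and, being positive, lies outside
        the lower tail.\<close>
      moreover have "g i = l * q"
        using w by (auto simp: g_def E_def)
      moreover have "l * (1 + real (n_neg m w (w i))) \<le> l * (q * real (n_pos m w (w i)))"
        using w l by (intro mult_left_mono) (auto simp: E_def)
      moreover have "l * q \<le> l"
        using l q by simp
      ultimately have "0 \<le> (\<Sum>j\<in>?J. g j)"
        by (simp add: algebra_simps)
      hence "1 \<le> ennreal (exp (\<Sum>j\<in>?J. g j))" by simp
      also have "\<dots> = (\<Prod>j\<in>?J. k (w i) (w j))"
        unfolding k_def g_def[symmetric] by (simp add: exp_sum prod_ennreal)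
      finally show ?thesis .
    qed
    thus "indicator E w \<le> (\<Prod>j\<in>?J. k (w i) (w j)) * indicator {0<..} (w i)"
      by (auto simp: indicator_def E_def)
  qed
  \<comment> \<open>Coordinate \<open>i\<close> becomes the outer variable \<open>t\<close>; given
    it, the other scores are still independent with law \<open>?D\<close>.\<close>
  also have "\<dots> = (\<integral>\<^sup>+t. (\<integral>\<^sup>+x. (\<Prod>j\<in>?J. k t (x j)) * indicator {0<..} t \<partial>(\<Pi>\<^sub>M j\<in>?J. ?D)) \<partial>?D)"
  proof -
    have P_eq: "P = (\<Pi>\<^sub>M j\<in>insert i ?J. ?D)"
      unfolding P_def using i by (simp add: insert_absorb)
    have meas: "(\<lambda>w. (\<Prod>j\<in>?J. k (w i) (w j)) * indicator {0<..} (w i)) \<in> borel_measurable P"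
      supply comp [measurable] using i by measurable
    show ?thesis
      using meas unfolding P_eq
      by (subst product_nn_integral_insert_rev)
        (auto intro!: nn_integral_cong prod.cong arg_cong2[where f = "(*)"])
  qed
  also have "\<dots> = (\<integral>\<^sup>+t. (\<integral>\<^sup>+x. k t x \<partial>?D) ^ (m - 1) * indicator {0<..} t \<partial>?D)"
  proof (rule nn_integral_cong)
    fix t
    have "(\<integral>\<^sup>+x. (\<Prod>j\<in>?J. k t (x j)) * indicator {0<..} t \<partial>(\<Pi>\<^sub>M j\<in>?J. ?D)) =
        (\<integral>\<^sup>+x. (\<Prod>j\<in>?J. k t (x j)) \<partial>(\<Pi>\<^sub>M j\<in>?J. ?D)) * indicator {0<..} t"
      by (rule nn_integral_multc) measurable
    also have "(\<integral>\<^sup>+x. (\<Prod>j\<in>?J. k t (x j)) \<partial>(\<Pi>\<^sub>M j\<in>?J. ?D)) = (\<integral>\<^sup>+x. k t x \<partial>?D) ^ (m - 1)"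
      using i by (subst product_nn_integral_prod) auto
    finally show "(\<integral>\<^sup>+x. (\<Prod>j\<in>?J. k t (x j)) * indicator {0<..} t \<partial>(\<Pi>\<^sub>M j\<in>?J. ?D)) =
        (\<integral>\<^sup>+x. k t x \<partial>?D) ^ (m - 1) * indicator {0<..} t" .
  qed
  also have "\<dots> \<le> (\<integral>\<^sup>+t. ennreal ((1 - c * measure ?D {..- t}) ^ (m - 1)) * indicator {0<..} t \<partial>?D)"
  proof (rule nn_integral_mono)
    fix t :: real
    have "(\<integral>\<^sup>+x. k t x \<partial>?D) ^ (m - 1) \<le> ennreal ((1 - c * measure ?D {..- t}) ^ (m - 1))" if t: "0 < t"
    proof -
      \<comment> \<open>As \<open>exp (l * q) > 1\<close>, the upper tail may be replaced by the
        larger lower tail; both weights then combine into \<open>- c\<close>.\<close>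
      have "(exp (l * q) - 1) * measure ?D {t..} \<le> (exp (l * q) - 1) * measure ?D {..- t}"
        using normal_upper_tail_le_lower_tail[OF \<sigma> \<mu>, of t] t l q by (intro mult_left_mono) auto
      hence le: "1 + (exp (l * q) - 1) * measure ?D {t..} + (exp (- l) - 1) * measure ?D {..- t} \<le>
          1 - c * measure ?D {..- t}"
        by (simp add: c_def algebra_simps)
      have "1 < exp (l * q)" using l q by simp
      hence "c < 1" unfolding c_def using exp_gt_zero[of "- l"] by linarith
      hence "c * measure ?D {..- t} \<le> 1 * 1"
        using c by (intro mult_mono) auto
      hence nonneg: "0 \<le> 1 - c * measure ?D {..- t}" by simp
      have "(\<integral>\<^sup>+x. k t x \<partial>?D) =
          ennreal (1 + (exp (l * q) - 1) * measure ?D {t..} + (exp (- l) - 1) * measure ?D {..- t})"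
        unfolding k_def by (rule nn_integral_exp_two_tails[OF D.prob_space_axioms _ t]) simp
      also have "\<dots> \<le> ennreal (1 - c * measure ?D {..- t})"
        by (rule ennreal_leI[OF le])
      finally have "(\<integral>\<^sup>+x. k t x \<partial>?D) ^ (m - 1) \<le> ennreal (1 - c * measure ?D {..- t}) ^ (m - 1)"
        by (rule power_mono) simp
      thus ?thesis using nonneg by (simp add: ennreal_power)
    qed
    thus "(\<integral>\<^sup>+x. k t x \<partial>?D) ^ (m - 1) * indicator {0<..} t \<le>
        ennreal ((1 - c * measure ?D {..- t}) ^ (m - 1)) * indicator {0<..} t"
      by (auto simp: indicator_def)
  qed
  finally show ?thesis unfolding E_def .
qed

text \<open>The margin vanishes at \<open>l = 0\<close> with derivative \<open>1 - q > 0\<close>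
  there. Convexity of \<open>exp\<close> between 0 and \<open>l\<close> makes explicit how small
  \<open>l\<close> should be.\<close>

lemma exp_weights_margin_pos:
  fixes q l :: real
  assumes q: "0 < q" "q < 1" and l: "0 < l" "q < exp (- l)"
  shows "0 < 2 - exp (- l) - exp (l * q)"
proof -
  have "exp ((1 - q) *\<^sub>R 0 + q *\<^sub>R l) \<le> (1 - q) * exp 0 + q * exp l"
    using q by (intro convex_onD[OF exp_convex]) auto
  hence "exp (l * q) - 1 \<le> q * (exp l - 1)"
    by (simp add: algebra_simps)
  also have "\<dots> < exp (- l) * (exp l - 1)"
    using l by (intro mult_strict_right_mono) auto
  also have "\<dots> = 1 - exp (- l)"
    by (simp add: algebra_simps exp_minus)
  finally show ?thesis by simp
qed

text \<open>The bound splits at \<open>K\<close>: \<open>a K m\<close> covers levels up to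
  \<open>K\<close> and vanishes as \<open>m\<close> grows, while \<open>b K\<close> covers the rest
  uniformly in \<open>m\<close> and vanishes as \<open>K\<close> grows.\<close>

lemma prob_rejections_nonempty_tendsto_0:
  assumes q: "0 < q" "q < 1" and \<sigma>: "0 < \<sigma>" and \<mu>: "\<mu> < 0"
  shows "(\<lambda>m. \<P>(w in (\<Pi>\<^sub>M i\<in>{1..m}. normal_law \<mu> \<sigma>). rejections m q w \<noteq> {})) \<longlonglongrightarrow> 0"
proof -
  let ?D = "normal_law \<mu> \<sigma>" and ?P = "\<lambda>m. \<Pi>\<^sub>M i\<in>{1..m}. normal_law \<mu> \<sigma>"
  let ?p = "\<lambda>t. measure ?D {..- t}"
  interpret D: prob_space ?D by (rule prob_space_normal_density[OF \<sigma>])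
  interpret product_prob_space "\<lambda>_::nat. ?D" by unfold_locales
  note [measurable] = borel_measurable_normal_lower_tail[OF \<sigma>]
  \<comment> \<open>Here \<open>exp (- l)\<close> is the midpoint of \<open>q\<close> and 1.\<close>
  define l where "l = - ln ((1 + q) / 2)"
  have l: "0 < l" "q < exp (- l)" using q by (auto simp: l_def)
  define c where "c = 2 - exp (- l) - exp (l * q)"
  have "0 < c" unfolding c_def by (rule exp_weights_margin_pos[OF q l])
  have "1 < exp (l * q)" using l q by simp
  hence "c < 1" unfolding c_def using exp_gt_zero[of "- l"] by linarith
  have cp: "0 \<le> 1 - c * ?p t" for t
    using mult_mono[of c 1 "?p t" 1] \<open>0 < c\<close> \<open>c < 1\<close> by simp
  define a where "a K m = real m * (1 - c * ?p K) ^ (m - 1)" for K :: real and m :: nat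
  define b where "b K = exp ((2 * \<mu> / \<sigma>\<^sup>2) * K) * (1 / c)" for K :: real
  have bound: "\<P>(w in ?P m. rejections m q w \<noteq> {}) \<le> a K m + b K" if K: "0 < K" for K m
  proof -
    interpret Q: prob_space "?P m" by (intro prob_space_PiM) unfold_locales
    define E where "E i = {w \<in> space (?P m). 0 < w i \<and>
      1 + real (n_neg m w (w i)) \<le> q * real (n_pos m w (w i))}" for i
    have E: "E i \<in> sets (?P m)" if "i \<in> {1..m}" for i
      unfolding E_def using that by (intro predE pred_admissible_score) (auto intro!: measurable_component_singleton)
    have "{w \<in> space (?P m). rejections m q w \<noteq> {}} = (\<Union>i\<in>{1..m}. E i)"
      unfolding rejections_nonempty_iff[OF q] E_def by auto
    hence "emeasure (?P m) {w \<in> space (?P m). rejections m q w \<noteq> {}} \<le> (\<Sum>i\<in>{1..m}. emeasure (?P m) (E i))"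
      using E by (auto intro!: emeasure_subadditive_finite)
    also have "\<dots> \<le> (\<Sum>i\<in>{1..m}. \<integral>\<^sup>+t. ennreal ((1 - c * ?p t) ^ (m - 1)) * indicator {0<..} t \<partial>?D)"
      unfolding E_def c_def using \<open>0 < c\<close> \<mu>
      by (intro sum_mono emeasure_admissible_score_le[OF q \<sigma> _ l(1)]) (auto simp: c_def)
    also have "\<dots> = ennreal (real m) * (\<integral>\<^sup>+t. ennreal ((1 - c * ?p t) ^ (m - 1)) * indicator {0<..} t \<partial>?D)"
      by (simp add: ennreal_of_nat_eq_real_of_nat)
    also have "\<dots> = (\<integral>\<^sup>+t. ennreal (real m * (1 - c * ?p t) ^ (m - 1)) * indicator {0<..} t \<partial>?D)"
    proof -
      have "ennreal (real m * (1 - c * ?p t) ^ (m - 1)) = ennreal (real m) * ennreal ((1 - c * ?p t) ^ (m - 1))" for t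
        by (intro ennreal_mult zero_le_power cp) simp
      thus ?thesis
        by (subst nn_integral_cmult[symmetric]) (simp_all add: mult.assoc)
    qed
    also have "\<dots> \<le> (\<integral>\<^sup>+t. ennreal (a K m) +
        ennreal (real m * (1 - c * ?p t) ^ (m - 1)) * indicator {K..} t \<partial>?D)"
    proof (rule nn_integral_mono)
      fix t :: real
      \<comment> \<open>For \<open>t \<le> K\<close> the lower tail beyond \<open>- t\<close>
        contains the one beyond \<open>- K\<close>, so the integrand is largest at
        \<open>K\<close>.\<close>
      have "real m * (1 - c * ?p t) ^ (m - 1) \<le> a K m" if "t \<le> K"
        unfolding a_def using that \<open>0 < c\<close> cp
        by (intro mult_left_mono power_mono diff_left_mono D.finite_measure_mono) auto
      thus "ennreal (real m * (1 - c * ?p t) ^ (m - 1)) * indicator {0<..} t \<le>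
          ennreal (a K m) + ennreal (real m * (1 - c * ?p t) ^ (m - 1)) * indicator {K..} t"
        by (auto simp: indicator_def ennreal_leI)
    qed
    also have "\<dots> = ennreal (a K m) +
        (\<integral>\<^sup>+t. ennreal (real m * (1 - c * ?p t) ^ (m - 1)) * indicator {K..} t \<partial>?D)"
      using D.emeasure_space_1 by (subst nn_integral_add) auto
    also have "(\<integral>\<^sup>+t. ennreal (real m * (1 - c * ?p t) ^ (m - 1)) * indicator {K..} t \<partial>?D) =
        (\<integral>\<^sup>+t. ennreal (normal_density \<mu> \<sigma> t) *
          (ennreal (real m * (1 - c * ?p t) ^ (m - 1)) * indicator {K..} t) \<partial>lborel)"
      by (rule nn_integral_density) auto
    \<comment> \<open>Reflection gains the factor
      \<open>exp ((2 * \<mu> / \<sigma>\<^sup>2) * K)\<close> and leaves the integrand of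
      \<open>nn_integral_lower_tail_power\<close>.\<close>
    also have "\<dots> \<le> (\<integral>\<^sup>+t. ennreal (exp ((2 * \<mu> / \<sigma>\<^sup>2) * K)) *
        (ennreal (real m * (1 - c * ?p t) ^ (m - 1) * normal_density \<mu> \<sigma> (- t)) * indicator {K..} t) \<partial>lborel)"
    proof (rule nn_integral_mono)
      fix t :: real
      have "normal_density \<mu> \<sigma> t * (real m * (1 - c * ?p t) ^ (m - 1)) \<le>
          exp ((2 * \<mu> / \<sigma>\<^sup>2) * K) * (real m * (1 - c * ?p t) ^ (m - 1) * normal_density \<mu> \<sigma> (- t))" if "K \<le> t"
      proof -
        have "(2 * \<mu> / \<sigma>\<^sup>2) * t \<le> (2 * \<mu> / \<sigma>\<^sup>2) * K"
          using that \<mu> by (intro mult_left_mono_neg) (auto simp: divide_nonpos_nonneg)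
        hence "normal_density \<mu> \<sigma> t \<le> exp ((2 * \<mu> / \<sigma>\<^sup>2) * K) * normal_density \<mu> \<sigma> (- t)"
          by (subst normal_density_reflect[OF \<sigma>]) (intro mult_right_mono, auto)
        hence "normal_density \<mu> \<sigma> t * (real m * (1 - c * ?p t) ^ (m - 1)) \<le>
            (exp ((2 * \<mu> / \<sigma>\<^sup>2) * K) * normal_density \<mu> \<sigma> (- t)) * (real m * (1 - c * ?p t) ^ (m - 1))"
          using cp by (intro mult_right_mono) auto
        thus ?thesis by (simp add: mult_ac)
      qed
      thus "ennreal (normal_density \<mu> \<sigma> t) *
          (ennreal (real m * (1 - c * ?p t) ^ (m - 1)) * indicator {K..} t) \<le>
        ennreal (exp ((2 * \<mu> / \<sigma>\<^sup>2) * K)) *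
        (ennreal (real m * (1 - c * ?p t) ^ (m - 1) * normal_density \<mu> \<sigma> (- t)) * indicator {K..} t)"
        using cp by (auto simp: indicator_def ennreal_mult[symmetric] intro!: ennreal_leI)
    qed
    also have "\<dots> = ennreal (exp ((2 * \<mu> / \<sigma>\<^sup>2) * K)) * (\<integral>\<^sup>+t.
        ennreal (real m * (1 - c * ?p t) ^ (m - 1) * normal_density \<mu> \<sigma> (- t)) * indicator {K..} t \<partial>lborel)"
      by (rule nn_integral_cmult) measurable
    also have "\<dots> \<le> ennreal (exp ((2 * \<mu> / \<sigma>\<^sup>2) * K)) * ennreal (1 / c)"
      using \<open>0 < c\<close> \<open>c < 1\<close> by (intro mult_left_mono nn_integral_lower_tail_power[OF \<sigma>]) auto
    also have "\<dots> = ennreal (b K)"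
      unfolding b_def using \<open>0 < c\<close> by (intro ennreal_mult[symmetric]) auto
    finally have "ennreal (\<P>(w in ?P m. rejections m q w \<noteq> {})) \<le> ennreal (a K m) + ennreal (b K)"
      unfolding Q.emeasure_eq_measure by (simp add: add_left_mono)
    moreover have "0 \<le> a K m" "0 \<le> b K"
      using cp \<open>0 < c\<close> by (auto simp: a_def b_def)
    ultimately show ?thesis
      by (simp add: ennreal_plus[symmetric] del: ennreal_plus)
  qed
  have "(b \<longlongrightarrow> 0 * (1 / c)) at_top"
    unfolding b_def using \<mu> \<sigma> by (intro tendsto_mult tendsto_const tendsto_exp_neg_mult) (simp add: divide_neg_pos)
  hence b_lim: "(b \<longlongrightarrow> 0) at_top" by simp
  have a_lim: "a K \<longlonglongrightarrow> 0" for K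
  proof -
    let ?r = "1 - c * ?p K"
    have "0 < c * ?p K" using \<open>0 < c\<close> normal_tail_pos(2)[OF \<sigma>, of \<mu> "- K"] by simp
    hence "norm ?r < 1" using cp[of K] by simp
    \<comment> \<open>Indexing by \<open>Suc n\<close> turns the exponent \<open>m - 1\<close> into
      \<open>n\<close> and the factor \<open>m\<close> into \<open>n + 1\<close>.\<close>
    hence "(\<lambda>n. real n * ?r ^ n + ?r ^ n) \<longlonglongrightarrow> 0 + 0"
      by (intro tendsto_add powser_times_n_limit_0 LIMSEQ_power_zero)
    hence "(\<lambda>n. a K (Suc n)) \<longlonglongrightarrow> 0"
      by (simp add: a_def algebra_simps)
    thus ?thesis by (rule LIMSEQ_imp_Suc)
  qed
  show ?thesis
  proof (rule tendstoI)
    \<comment> \<open>First \<open>K\<close> is chosen to make \<open>b K\<close> small for all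
      \<open>m\<close> at once; then \<open>m\<close> grows with \<open>K\<close> fixed.\<close>
    fix e :: real assume "0 < e"
    have "\<forall>\<^sub>F K in at_top. 0 < K \<and> b K < e / 2"
      using \<open>0 < e\<close> by (intro eventually_conj eventually_gt_at_top order_tendstoD(2)[OF b_lim]) auto
    then obtain K where K: "0 < K" "b K < e / 2"
      by (auto dest!: eventually_happens)
    have "\<forall>\<^sub>F m in sequentially. a K m < e / 2"
      using \<open>0 < e\<close> by (intro order_tendstoD(2)[OF a_lim]) auto
    thus "\<forall>\<^sub>F m in sequentially. dist (\<P>(w in ?P m. rejections m q w \<noteq> {})) 0 < e"
    proof eventually_elim
      case (elim m)
      with bound[OF K(1), of m] K(2) show ?case
        by (simp add: measure_nonneg)
    qed
  qed
qed

subsection \<open>Mixing over the common factor\<close>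

lemma normal_law_eq_distr:
  assumes "0 < \<sigma>"
  shows "normal_law \<mu> \<sigma> = distr (normal_law 0 1) lborel (\<lambda>x. \<mu> + \<sigma> * x)"
proof -
  interpret prob_space "normal_law 0 1" by (rule prob_space_normal_density) simp
  have "distributed (normal_law 0 1) lborel (\<lambda>x. x) (normal_density 0 1)"
    by (auto simp: distributed_def intro!: distr_id2)
  from normal_density_affine[OF this, of \<sigma> \<mu>] assms
  have "distributed (normal_law 0 1) lborel (\<lambda>x. \<mu> + \<sigma> * x) (normal_density \<mu> \<sigma>)"
    by simp
  from distributed_distr_eq_density[OF this] show ?thesis by simp
qed

text \<open>The law of the scores is the image of a standard normal product under a coordinatewise
  affine map. This moves the parameters from the measure into the integrand, which later gives
  measurability in \<open>z\<close>.\<close>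

lemma emeasure_rejections_affine:
  assumes \<sigma>: "0 < \<sigma>" and q: "0 < q" "q < 1"
  shows "emeasure (\<Pi>\<^sub>M i\<in>{1..m}. normal_law \<mu> \<sigma>)
      {w \<in> space (\<Pi>\<^sub>M i\<in>{1..m}. normal_law \<mu> \<sigma>). rejections m q w \<noteq> {}} =
    (\<integral>\<^sup>+x. indicator {x. rejections m q (\<lambda>i. \<mu> + \<sigma> * x i) \<noteq> {}} x \<partial>(\<Pi>\<^sub>M i\<in>{1..m}. normal_law 0 1))"
proof -
  let ?S = "\<Pi>\<^sub>M i\<in>{1..m}. normal_law 0 1" and ?T = "\<Pi>\<^sub>M i\<in>{1..m}. normal_law \<mu> \<sigma>"
  let ?f = "\<lambda>x. \<mu> + \<sigma> * x"
  have borel: "sets ?T = sets (\<Pi>\<^sub>M i\<in>{1..m}. borel)"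
    by (intro sets_PiM_cong) auto
  have "Measurable.pred ?T (\<lambda>w. rejections m q w \<noteq> {})"
    by (rule pred_rejections_nonempty[OF _ q])
      (auto simp: measurable_cong_sets[OF borel refl] intro!: measurable_component_singleton)
  hence T: "{w \<in> space ?T. rejections m q w \<noteq> {}} \<in> sets ?T"
    by (rule predE)
  have f: "compose {1..m} ?f \<in> measurable ?S ?T"
    unfolding compose_def by (rule measurable_restrict) measurable
  have "distr ?S ?T (compose {1..m} ?f) = (\<Pi>\<^sub>M i\<in>{1..m}. distr (normal_law 0 1) (normal_law \<mu> \<sigma>) ?f)"
    by (rule distr_PiM_finite_prob_space') (auto intro!: prob_space_normal_density \<sigma>)
  also have "distr (normal_law 0 1) (normal_law \<mu> \<sigma>) ?f = normal_law \<mu> \<sigma>"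
    unfolding normal_law_eq_distr[OF \<sigma>, of \<mu>] by (rule distr_cong) auto
  finally have law: "distr ?S ?T (compose {1..m} ?f) = ?T" .
  have "emeasure ?T {w \<in> space ?T. rejections m q w \<noteq> {}} =
      emeasure (distr ?S ?T (compose {1..m} ?f)) {w \<in> space ?T. rejections m q w \<noteq> {}}"
    by (simp only: law)
  also have "\<dots> = (\<integral>\<^sup>+w. indicator {w \<in> space ?T. rejections m q w \<noteq> {}} w \<partial>distr ?S ?T (compose {1..m} ?f))"
    using T by simp
  also have "\<dots> = (\<integral>\<^sup>+x. indicator {w \<in> space ?T. rejections m q w \<noteq> {}} (compose {1..m} ?f x) \<partial>?S)"
    using T f by (intro nn_integral_distr) auto
  also have "\<dots> = (\<integral>\<^sup>+x. indicator {x. rejections m q (\<lambda>i. \<mu> + \<sigma> * x i) \<noteq> {}} x \<partial>?S)"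
  proof (rule nn_integral_cong)
    fix x assume "x \<in> space ?S"
    hence "compose {1..m} ?f x \<in> space ?T"
      using measurable_space[OF f] by simp
    moreover have "rejections m q (compose {1..m} ?f x) \<noteq> {} \<longleftrightarrow> rejections m q (\<lambda>i. \<mu> + \<sigma> * x i) \<noteq> {}"
      by (rule rejections_cong[OF _ q]) (simp add: compose_eq)
    ultimately show "indicator {w \<in> space ?T. rejections m q w \<noteq> {}} (compose {1..m} ?f x) =
        (indicator {x. rejections m q (\<lambda>i. \<mu> + \<sigma> * x i) \<noteq> {}} x :: ennreal)"
      by (simp add: indicator_def)
  qed
  finally show ?thesis .
qed

text \<open>At mean 0 and level 0 the two tail comparisons give equal half-line probabilities, and
  the point 0 has no mass.\<close>

lemma normal_law_half: "measure (normal_law 0 1) {0<..} = 1 / 2"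
proof -
  interpret prob_space "normal_law 0 1" by (rule prob_space_normal_density) simp
  have "{0} \<in> null_sets (normal_law 0 1)"
    by (subst null_sets_density_iff, simp, rule conjI, simp, rule eventually_mono[OF AE_lborel_singleton[of 0]]) simp
  hence 0: "measure (normal_law 0 1) {0} = 0"
    by (rule measure_eq_0_null_sets)
  have "measure (normal_law 0 1) ({0} \<union> {0<..}) = measure (normal_law 0 1) {0} + measure (normal_law 0 1) {0<..}"
    by (rule finite_measure_Union) auto
  moreover have "measure (normal_law 0 1) ({..0} \<union> {0<..}) = measure (normal_law 0 1) {..0} + measure (normal_law 0 1) {0<..}"
    by (rule finite_measure_Union) auto
  moreover have "{0} \<union> {0<..} = {0::real..}" "{..0} \<union> {0<..} = (UNIV :: real set)" by auto
  moreover have "measure (normal_law 0 1) UNIV = 1"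
    using prob_space by simp
  ultimately show ?thesis
    using normal_tail_ratio[of 1 0 0] normal_upper_tail_le_lower_tail[of 1 0 0] 0 by simp
qed

text \<open>The vector of \<open>Z 0\<close> to \<open>Z m\<close> has a product law, so integrating
  out coordinates 1 to \<open>m\<close> first leaves the conditional rejection probability at
  \<open>Z 0 = z\<close>.\<close>

lemma fdr_score_eq_mixture:
  fixes Z :: "nat \<Rightarrow> 'a \<Rightarrow> real"
  assumes q: "0 < q" "q < 1" and \<rho>: "0 < \<rho>" "\<rho> < 1"
    and "prob_space M" and indep: "prob_space.indep_vars M (\<lambda>_. borel) Z UNIV"
    and Z: "\<And>i. distributed M lborel (Z i) std_normal_density"
  defines "p \<equiv> \<lambda>z m. \<P>(w in conditional_score_law \<rho> z m. rejections m q w \<noteq> {})"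
  shows "(\<lambda>z. p z m) \<in> borel_measurable borel" (is ?meas)
    and "fdr M m q {1..m} (score \<rho> Z) = (\<integral>z. p z m \<partial>normal_law 0 1)" (is ?eq)
proof -
  interpret M: prob_space M by fact
  let ?N = "normal_law 0 1" and ?S = "\<Pi>\<^sub>M i\<in>{1..m}. normal_law 0 1"
  interpret N: prob_space ?N by (rule prob_space_normal_density) simp
  interpret product_prob_space "\<lambda>_::nat. ?N" by unfold_locales
  have \<sigma>: "0 < sqrt (1 - \<rho>)" using \<rho> by simp
  define R where "R x \<longleftrightarrow> rejections m q (\<lambda>i. sqrt \<rho> * x 0 + sqrt (1 - \<rho>) * x i) \<noteq> {}" for x :: "nat \<Rightarrow> real"
  have rv [measurable]: "Z i \<in> borel_measurable M" for i
    using distributed_measurable[OF Z[of i]] by simp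
  have law: "distr M (\<Pi>\<^sub>M i\<in>{0..m}. borel) (\<lambda>\<omega>. \<lambda>i\<in>{0..m}. Z i \<omega>) = (\<Pi>\<^sub>M i\<in>{0..m}. ?N)"
  proof -
    have Z_law: "distr M borel (Z i) = ?N" for i
    proof -
      have "distr M borel (Z i) = distr M lborel (Z i)" by (rule distr_cong) auto
      thus ?thesis using distributed_distr_eq_density[OF Z[of i]] by simp
    qed
    have "M.indep_vars (\<lambda>_. borel) Z {0..m}"
      by (rule M.indep_vars_subset[OF indep]) auto
    thus ?thesis
      by (subst (asm) M.indep_vars_iff_distr_eq_PiM) (simp_all add: Z_law)
  qed
  have R_meas [measurable]: "Measurable.pred (\<Pi>\<^sub>M i\<in>{0..m}. borel) R"
    unfolding R_def by (rule pred_rejections_nonempty[OF _ q]) measurable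
  have R_meas': "(\<lambda>x. if R x then 1 else 0 :: real) \<in> borel_measurable (\<Pi>\<^sub>M i\<in>{0..m}. ?N)"
  proof -
    have "sets (\<Pi>\<^sub>M i\<in>{0..m}. ?N) = sets (\<Pi>\<^sub>M i\<in>{0..m}. borel)"
      by (rule sets_PiM_cong) auto
    thus ?thesis
      unfolding measurable_cong_sets[OF _ refl] by measurable
  qed
  \<comment> \<open>Unlike \<open>R\<close>, this keeps the common factor as a separate argument, so
    that joint measurability in \<open>z\<close> and \<open>x\<close> can be stated.\<close>
  define G where "G z x = (indicator {x. rejections m q (\<lambda>i. sqrt \<rho> * z + sqrt (1 - \<rho>) * x i) \<noteq> {}} x :: ennreal)"
    for z and x :: "nat \<Rightarrow> real"
  have pred_pair: "Measurable.pred (borel \<Otimes>\<^sub>M ?S)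
      (\<lambda>p. rejections m q (\<lambda>i. sqrt \<rho> * fst p + sqrt (1 - \<rho>) * snd p i) \<noteq> {})"
    by (rule pred_rejections_nonempty[OF _ q]) measurable
  have [measurable]: "case_prod G \<in> borel_measurable (borel \<Otimes>\<^sub>M ?S)"
  proof -
    have "(\<lambda>p. if rejections m q (\<lambda>i. sqrt \<rho> * fst p + sqrt (1 - \<rho>) * snd p i) \<noteq> {} then 1 else 0 :: ennreal)
        \<in> borel_measurable (borel \<Otimes>\<^sub>M ?S)"
      by (rule measurable_If[OF _ _ predE[OF pred_pair]]) auto
    also have "(\<lambda>p. if rejections m q (\<lambda>i. sqrt \<rho> * fst p + sqrt (1 - \<rho>) * snd p i) \<noteq> {} then 1 else 0 :: ennreal) = case_prod G"
      by (auto simp: G_def fun_eq_iff)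
    finally show ?thesis .
  qed
  have p_eq: "ennreal (p z m) = (\<integral>\<^sup>+x. G z x \<partial>?S)" for z
  proof -
    interpret Q: prob_space "\<Pi>\<^sub>M i\<in>{1..m}. normal_law (sqrt \<rho> * z) (sqrt (1 - \<rho>))"
      by (intro prob_space_PiM prob_space_normal_density \<sigma>)
    show ?thesis
      unfolding p_def conditional_score_law_def G_def emeasure_rejections_affine[OF \<sigma> q, symmetric]
      by (rule Q.emeasure_eq_measure[symmetric])
  qed
  have p_nonneg: "0 \<le> p z m" for z by (simp add: p_def)
  interpret S: prob_space ?S by (intro prob_space_PiM N.prob_space_axioms)
  have "(\<lambda>z. \<integral>\<^sup>+x. G z x \<partial>?S) \<in> borel_measurable borel"
    by (rule S.borel_measurable_nn_integral) measurable
  hence "(\<lambda>z. enn2real (ennreal (p z m))) \<in> borel_measurable borel"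
    unfolding p_eq by measurable
  thus meas: ?meas by (simp add: p_nonneg)
  have "fdr M m q {1..m} (score \<rho> Z) = (\<integral>\<omega>. (if R (\<lambda>i\<in>{0..m}. Z i \<omega>) then 1 else 0) \<partial>M)"
  proof -
    have "rejections m q (\<lambda>i. score \<rho> Z i \<omega>) \<noteq> {} \<longleftrightarrow> R (\<lambda>i\<in>{0..m}. Z i \<omega>)" for \<omega>
      unfolding R_def by (rule rejections_cong[OF _ q]) (auto simp: score_def)
    hence "fdp m q {1..m} (\<lambda>i. score \<rho> Z i \<omega>) = (if R (\<lambda>i\<in>{0..m}. Z i \<omega>) then 1 else 0)" for \<omega>
      by (simp only: fdp_all_null indicator_def mem_Collect_eq of_bool_def)
    thus ?thesis
      by (simp only: fdr_def)
  qed
  also have "\<dots> = (\<integral>x. (if R x then 1 else 0) \<partial>distr M (\<Pi>\<^sub>M i\<in>{0..m}. borel) (\<lambda>\<omega>. \<lambda>i\<in>{0..m}. Z i \<omega>))"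
    by (rule integral_distr[symmetric]) measurable
  also have "\<dots> = (\<integral>x. (if R x then 1 else 0) \<partial>(\<Pi>\<^sub>M i\<in>{0..m}. ?N))"
    by (simp only: law)
  also have "\<dots> = enn2real (\<integral>\<^sup>+x. ennreal (if R x then 1 else 0) \<partial>(\<Pi>\<^sub>M i\<in>{0..m}. ?N))"
    by (rule integral_eq_nn_integral[OF R_meas']) simp
  also have "(\<integral>\<^sup>+x. ennreal (if R x then 1 else 0) \<partial>(\<Pi>\<^sub>M i\<in>{0..m}. ?N)) = (\<integral>\<^sup>+z. \<integral>\<^sup>+x. G z x \<partial>?S \<partial>?N)"
  proof -
    \<comment> \<open>Coordinate 0 is split off as the outer variable.\<close>
    have ins: "{0..m} = insert 0 {1..m}" by auto
    have G: "ennreal (if R (x(0 := z)) then 1 else 0) = G z x" for x z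
    proof -
      have "R (x(0 := z)) \<longleftrightarrow> rejections m q (\<lambda>i. sqrt \<rho> * z + sqrt (1 - \<rho>) * x i) \<noteq> {}"
        unfolding R_def by (rule rejections_cong[OF _ q]) auto
      thus ?thesis by (simp add: G_def)
    qed
    have "(\<lambda>x. ennreal (if R x then 1 else 0)) \<in> borel_measurable (\<Pi>\<^sub>M i\<in>{0..m}. ?N)"
      using R_meas' by (rule measurable_compose) simp
    hence "(\<integral>\<^sup>+x. ennreal (if R x then 1 else 0) \<partial>(\<Pi>\<^sub>M i\<in>{0..m}. ?N)) =
        (\<integral>\<^sup>+z. \<integral>\<^sup>+x. ennreal (if R (x(0 := z)) then 1 else 0) \<partial>?S \<partial>?N)"
      unfolding ins by (rule product_nn_integral_insert_rev[rotated 2]) simp_all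
    thus ?thesis by (simp only: G)
  qed
  also have "\<dots> = (\<integral>\<^sup>+z. ennreal (p z m) \<partial>?N)"
    by (simp add: p_eq)
  also have "enn2real \<dots> = (\<integral>z. p z m \<partial>?N)"
    using meas by (subst integral_eq_nn_integral) (auto simp: p_nonneg)
  finally show ?eq .
qed

section \<open>Conditional limits and the limit of the FDR\<close>

theorem theorem1:
  fixes M :: "'a measure" and Z :: "nat \<Rightarrow> 'a \<Rightarrow> real" and q \<rho> :: real
  assumes "0 < q" "q < 1" "0 < \<rho>" "\<rho> < 1"
    and "prob_space M"
    and "prob_space.indep_vars M (\<lambda>_. borel) Z UNIV"
    and "\<And>i. distributed M lborel (Z i) std_normal_density"
  shows "(\<forall>z. z \<noteq> 0 \<longrightarrow>
           (\<lambda>m. \<P>(w in conditional_score_law \<rho> z m. rejections m q w \<noteq> {}))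
             \<longlonglongrightarrow> (if z > 0 then 1 else 0)) \<and>
         (\<lambda>m. fdr M m q {1..m} (score \<rho> Z)) \<longlonglongrightarrow> 1 / 2 \<and>
         (q < 1 / 2 \<longrightarrow> (\<forall>\<^sub>F m in sequentially. fdr M m q {1..m} (score \<rho> Z) > q))"
proof (intro conjI allI impI)
  let ?N = "normal_law 0 1"
  let ?p = "\<lambda>z m. \<P>(w in conditional_score_law \<rho> z m. rejections m q w \<noteq> {})"
  note mixture = fdr_score_eq_mixture[OF assms]
  have \<sigma>: "0 < sqrt (1 - \<rho>)" using assms by simp
  show cond: "?p z \<longlonglongrightarrow> (if z > 0 then 1 else 0)" if "z \<noteq> 0" for z
  \<comment> \<open>The conditional mean \<open>sqrt \<rho> * z\<close> has the sign of
    \<open>z\<close>.\<close>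
  proof (cases "z > 0")
    case True
    thus ?thesis
      using prob_rejections_nonempty_tendsto_1[OF assms(1,2) \<sigma>, of "sqrt \<rho> * z"] assms(3)
      by (simp add: conditional_score_law_def)
  next
    case False
    with that have "sqrt \<rho> * z < 0" using assms(3) by (simp add: mult_pos_neg)
    with False show ?thesis
      using prob_rejections_nonempty_tendsto_0[OF assms(1,2) \<sigma>, of "sqrt \<rho> * z"]
      by (simp add: conditional_score_law_def)
  qed
  interpret N: prob_space ?N by (rule prob_space_normal_density) simp
  \<comment> \<open>The value \<open>z = 0\<close>, where no conditional limit has been established,
    has probability 0.\<close>
  have "AE z in ?N. z \<noteq> 0"
    by (subst AE_density, simp, rule eventually_mono[OF AE_lborel_singleton[of 0]]) simp
  hence ae: "AE z in ?N. ?p z \<longlonglongrightarrow> indicator {0<..} z"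
  proof eventually_elim
    case (elim z)
    from cond[OF this] show ?case by (auto simp: indicator_def)
  qed
  have "?p z m \<le> 1" for z m
    unfolding conditional_score_law_def
    by (intro prob_space.prob_le_1 prob_space_PiM prob_space_normal_density \<sigma>)
  hence "(\<lambda>m. \<integral>z. ?p z m \<partial>?N) \<longlonglongrightarrow> (\<integral>z. indicator {0<..} z \<partial>?N)"
    using mixture(1) ae by (intro integral_dominated_convergence[where w = "\<lambda>_. 1"]) auto
  also have "(\<integral>z. indicator {0<..} z \<partial>?N) = (1 / 2 :: real)"
    using normal_law_half by simp
  finally show lim: "(\<lambda>m. fdr M m q {1..m} (score \<rho> Z)) \<longlonglongrightarrow> 1 / 2"
    by (simp only: mixture(2))
  show "\<forall>\<^sub>F m in sequentially. fdr M m q {1..m} (score \<rho> Z) > q" if "q < 1 / 2"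
    by (rule order_tendstoD(1)[OF lim that])
qed

end
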